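(* Every randomised online algorithm for MPMD-Set with size-based delay has competitive ratio $\Omega(\log n)$, where $n$ is the number of points in the metric space.
   Context: MPMD-Set with size-based delay: a metric space $(V,d)$ with $n$ points; requests arrive online at points of $V$ at discrete timesteps; the algorithm irrevocably matches requests in pairs, eventually producing a perfect matching; at each timestep $t$ a delay function $f_t$ on sets of requests is charged on the set $U_t$ of arrived-but-unmatched requests, where $f_t(\emptyset)=0$, $f_t$ is monotone under inclusion, $\sum_t f_t(U)=\infty$ for nonempty $U$, and $f_t(U)$ depends only on $|U|$ and is non-decreasing in $|U|$. Total cost is the sum of distances of matched pairs plus $\sum_t f_t(U_t)$. A randomised algorithm is $c$-competitive if its expected cost is at most $c$ times optimal offline cost on every instance. *)

theory Defs
  imports "HOL-Probability.Probability"
begin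

text \<open>
  The points of the metric space are natural numbers; since only finite metric spaces occur, this
  is no restriction. Requests are referred to by their position in the request sequence: request
  \<open>i\<close> is the pair \<open>requests I ! i\<close> consisting of its arrival time and its location.
\<close>

record mpmd_instance =
  points :: "nat set"
  metric :: "nat \<Rightarrow> nat \<Rightarrow> real"
  requests :: "(nat \<times> nat) list"
  delay :: "nat \<Rightarrow> nat set \<Rightarrow> real"

definition set_delay :: "(nat \<Rightarrow> nat set \<Rightarrow> real) \<Rightarrow> bool" where
  "set_delay f \<longleftrightarrow>
     (\<forall>t. f t {} = 0) \<and>
     (\<forall>t U W. finite W \<and> U \<subseteq> W \<longrightarrow> f t U \<le> f t W) \<and>
     (\<forall>U. finite U \<and> U \<noteq> {} \<longrightarrow> (\<Sum>t. ennreal (f t U)) = \<infinity>)"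

text \<open>
  The single implication below also says that \<open>f t U\<close> depends only on \<open>card U\<close>: apply it in both
  directions to two sets of equal cardinality.
\<close>

definition size_based :: "(nat \<Rightarrow> nat set \<Rightarrow> real) \<Rightarrow> bool" where
  "size_based f \<longleftrightarrow>
     (\<forall>t U W. finite U \<and> finite W \<and> card U \<le> card W \<longrightarrow> f t U \<le> f t W)"

text \<open>The number of requests is even, as otherwise there is no perfect matching.\<close>

definition size_based_instance :: "mpmd_instance \<Rightarrow> bool" where
  "size_based_instance I \<longleftrightarrow>
     finite (points I) \<and> Metric_space (points I) (metric I) \<and>
     snd ` set (requests I) \<subseteq> points I \<and> sorted (map fst (requests I)) \<and>
     even (length (requests I)) \<and>
     set_delay (delay I) \<and> size_based (delay I)"

definition arrived :: "mpmd_instance \<Rightarrow> nat \<Rightarrow> nat set" where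
  "arrived I t = {i. i < length (requests I) \<and> fst (requests I ! i) \<le> t}"

text \<open>A matched pair of requests is represented once, with the smaller position first.\<close>

type_synonym matching = "(nat \<times> nat) set"

definition matched :: "matching \<Rightarrow> nat set" where
  "matched M = fst ` M \<union> snd ` M"

definition is_matching :: "matching \<Rightarrow> bool" where
  "is_matching M \<longleftrightarrow>
     (\<forall>(i, j) \<in> M. i < j) \<and>
     (\<forall>e \<in> M. \<forall>e' \<in> M. e \<noteq> e' \<longrightarrow> {fst e, snd e} \<inter> {fst e', snd e'} = {})"

text \<open>
  A schedule \<open>\<mu>\<close> gives the set \<open>\<mu> t\<close> of all pairs matched up to and including timestep \<open>t\<close>.
  Monotonicity in \<open>t\<close> expresses that matching two requests is irrevocable.
\<close>

definition schedule :: "mpmd_instance \<Rightarrow> (nat \<Rightarrow> matching) \<Rightarrow> bool" where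
  "schedule I \<mu> \<longleftrightarrow> mono \<mu> \<and> (\<forall>t. is_matching (\<mu> t) \<and> matched (\<mu> t) \<subseteq> arrived I t)"

definition eventually_perfect :: "mpmd_instance \<Rightarrow> (nat \<Rightarrow> matching) \<Rightarrow> bool" where
  "eventually_perfect I \<mu> \<longleftrightarrow> (\<exists>t. matched (\<mu> t) = {..<length (requests I)})"

definition connection_cost :: "mpmd_instance \<Rightarrow> matching \<Rightarrow> real" where
  "connection_cost I M =
     (\<Sum>(i, j) \<in> M. metric I (snd (requests I ! i)) (snd (requests I ! j)))"

text \<open>
  The delay at \<open>t\<close> is charged on the requests still unmatched after the matching decisions of
  timestep \<open>t\<close>, so a request matched on arrival incurs none.
\<close>

definition total_cost :: "mpmd_instance \<Rightarrow> (nat \<Rightarrow> matching) \<Rightarrow> ennreal" where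
  "total_cost I \<mu> =
     ennreal (connection_cost I (\<Union>t. \<mu> t)) +
     (\<Sum>t. ennreal (delay I t (arrived I t - matched (\<mu> t))))"

definition opt_cost :: "mpmd_instance \<Rightarrow> ennreal" where
  "opt_cost I = (INF \<mu> \<in> {\<mu>. schedule I \<mu> \<and> eventually_perfect I \<mu>}. total_cost I \<mu>)"

text \<open>
  What an online algorithm knows when deciding at timestep \<open>t\<close>: the metric space, the requests
  that have arrived by \<open>t\<close>, and the delay functions of timesteps \<open>0, \<dots>, t\<close>. The current timestep is
  the length of the last component minus one.
\<close>

type_synonym history =
  "nat set \<times> (nat \<Rightarrow> nat \<Rightarrow> real) \<times> (nat \<times> nat) list \<times> (nat set \<Rightarrow> real) list"

definition history :: "mpmd_instance \<Rightarrow> nat \<Rightarrow> history" where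
  "history I t =
     (points I, metric I, filter (\<lambda>r. fst r \<le> t) (requests I), map (delay I) [0..<Suc t])"

text \<open>
  A deterministic online algorithm maps a history to the set of all pairs matched so far. A
  randomised one is a family of deterministic ones indexed by the outcomes of a probability space.
\<close>

definition run :: "(history \<Rightarrow> matching) \<Rightarrow> mpmd_instance \<Rightarrow> nat \<Rightarrow> matching" where
  "run B I t = B (history I t)"

definition randomised_online_algorithm ::
  "'w measure \<Rightarrow> ('w \<Rightarrow> history \<Rightarrow> matching) \<Rightarrow> bool" where
  "randomised_online_algorithm P A \<longleftrightarrow>
     prob_space P \<and>
     (\<forall>I. size_based_instance I \<longrightarrow>
        (\<forall>t. (\<lambda>w. run (A w) I t) \<in> measurable P (count_space UNIV)) \<and>
        (\<forall>w \<in> space P. schedule I (run (A w) I)) \<and>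
        (AE w in P. eventually_perfect I (run (A w) I)))"

definition expected_cost ::
  "'w measure \<Rightarrow> ('w \<Rightarrow> history \<Rightarrow> matching) \<Rightarrow> mpmd_instance \<Rightarrow> ennreal" where
  "expected_cost P A I = (\<integral>\<^sup>+ w. total_cost I (run (A w) I) \<partial>P)"

definition competitive ::
  "'w measure \<Rightarrow> ('w \<Rightarrow> history \<Rightarrow> matching) \<Rightarrow> nat \<Rightarrow> ennreal \<Rightarrow> bool" where
  "competitive P A n c \<longleftrightarrow>
     (\<forall>I. size_based_instance I \<and> card (points I) = n \<longrightarrow>
        expected_cost P A I \<le> c * opt_cost I)"

text \<open>The competitive ratio as a function of the number \<open>n\<close> of points; possibly infinite.\<close>

definition competitive_ratio ::
  "'w measure \<Rightarrow> ('w \<Rightarrow> history \<Rightarrow> matching) \<Rightarrow> nat \<Rightarrow> ennreal" where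
  "competitive_ratio P A n = Inf {c. competitive P A n c}"

end

theory Submission
  imports Defs "HOL-Combinatorics.Permutations"
begin

text \<open>
  On the uniform metric, one request arrives at each of the \<open>n\<close> points at time \<open>0\<close>. At time
  \<open>k + 1\<close>, for \<open>k < n - 2\<close>, a second request arrives at the point \<open>\<sigma> k\<close>, where \<open>\<sigma>\<close> is a permutation
  of the points. The delay at time \<open>t\<close> is \<open>0\<close> if at most \<open>n - 2 - t\<close> requests are pending, and
  prohibitive otherwise. The offline optimum matches the requests at the two points that are never
  requested again, at cost \<open>1\<close>, and all others at cost \<open>0\<close>. An online algorithm has at most
  \<open>n - 2 - k\<close> pending requests at the end of time \<open>k\<close>, so at least two of the \<open>n - k\<close> points not yet
  requested again have none. By averaging, the adversary can choose one of those \<open>n - k\<close> points as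
  \<open>\<sigma> k\<close> such that with probability at least \<open>2 / (n - k)\<close> it has no pending request, in which case
  a pairing at distance \<open>0\<close> is lost. Summing over \<open>k\<close> gives \<open>2 (harm n - harm 2)\<close>.
\<close>

section \<open>The hard instances and what they reveal over time\<close>

definition hard_instance :: "nat \<Rightarrow> (nat \<Rightarrow> nat) \<Rightarrow> mpmd_instance" where
  "hard_instance n \<sigma> =
     \<lparr>points = {..<n},
      metric = (\<lambda>x y. if x = y then 0 else 1),
      requests = map (\<lambda>p. (0, p)) [0..<n] @ map (\<lambda>i. (Suc i, \<sigma> i)) [0..<n - 2],
      delay = (\<lambda>t U. if card U > n - 2 - t then real n else 0)\<rparr>"

lemma hard_instance_simps [simp]:
  "points (hard_instance n \<sigma>) = {..<n}"
  "metric (hard_instance n \<sigma>) x y = (if x = y then 0 else 1)"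
  "delay (hard_instance n \<sigma>) t U = (if card U > n - 2 - t then real n else 0)"
  "length (requests (hard_instance n \<sigma>)) = n + (n - 2)"
  by (simp_all add: hard_instance_def)

text \<open>Positions and points agree below \<open>n\<close>: a number \<open>p < n\<close> is
  later read both as a point and as the first request there. This is why
  \<open>\<sigma> k \<in> matched M\<close> can speak of the initial request at the point
  \<open>\<sigma> k\<close>.\<close>

lemma requests_hard_instance_initial [simp]:
  "p < n \<Longrightarrow> requests (hard_instance n \<sigma>) ! p = (0, p)"
  by (simp add: hard_instance_def nth_append)

lemma requests_hard_instance_later [simp]:
  "k < n - 2 \<Longrightarrow> requests (hard_instance n \<sigma>) ! (n + k) = (Suc k, \<sigma> k)"
  by (simp add: hard_instance_def nth_append)

lemma arrived_hard_instance:
  "arrived (hard_instance n \<sigma>) t = {..<n + min t (n - 2)}"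
proof (intro equalityI subsetI)
  fix i assume i: "i \<in> arrived (hard_instance n \<sigma>) t"
  show "i \<in> {..<n + min t (n - 2)}"
  proof (cases "i < n")
    case False
    then obtain k where "i = n + k" by (metis le_Suc_ex not_less)
    with i show ?thesis by (auto simp: arrived_def)
  qed auto
next
  fix i assume i: "i \<in> {..<n + min t (n - 2)}"
  show "i \<in> arrived (hard_instance n \<sigma>) t"
  proof (cases "i < n")
    case False
    then obtain k where "i = n + k" by (metis le_Suc_ex not_less)
    with i show ?thesis by (auto simp: arrived_def)
  qed (auto simp: arrived_def)
qed

lemma size_based_instance_hard_instance:
  assumes n: "n \<ge> 2" and \<sigma>: "\<sigma> permutes {..<n}"
  shows "size_based_instance (hard_instance n \<sigma>)"
proof -
  let ?f = "delay (hard_instance n \<sigma>)"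
  have inf: "(\<Sum>t. ennreal (?f t U)) = \<infinity>" if U: "finite U" "U \<noteq> {}" for U
  proof (rule ccontr)
    assume "(\<Sum>t. ennreal (?f t U)) \<noteq> \<infinity>"
    then have "summable (\<lambda>t. ?f t U)"
      by (intro summable_suminf_not_top) auto
    then have "(\<lambda>t. ?f t U) \<longlonglongrightarrow> 0"
      by (rule summable_LIMSEQ_zero)
    \<comment> \<open>From time \<open>n - 2\<close> on, truncated subtraction makes the threshold
      \<open>0\<close>, so every nonempty finite set is charged \<open>n\<close>.\<close>
    moreover have "eventually (\<lambda>t. ?f t U = real n) sequentially"
      using eventually_ge_at_top[of "n - 2"]
      by eventually_elim (use U in \<open>auto simp: card_gt_0_iff\<close>)
    then have "(\<lambda>t. ?f t U) \<longlonglongrightarrow> real n"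
      by (rule tendsto_eventually)
    ultimately show False
      using n LIMSEQ_unique by fastforce
  qed
  have mono: "?f t U \<le> ?f t W" if "finite W" "U \<subseteq> W" for t U W
    using card_mono[OF that] by auto
  have "?f t {} = 0" for t
    by simp
  with inf mono have "set_delay ?f"
    unfolding set_delay_def by blast
  moreover have "size_based ?f"
    unfolding size_based_def by auto
  moreover have "Metric_space {..<n} (metric (hard_instance n \<sigma>))"
    by unfold_locales auto
  moreover have "snd ` set (requests (hard_instance n \<sigma>)) \<subseteq> {..<n}"
  proof -
    have "\<sigma> k < n" if "k < n" for k
      using permutes_in_image[OF \<sigma>, of k] that by simp
    then show ?thesis by (auto simp: hard_instance_def)
  qed
  moreover have "sorted (map fst (requests (hard_instance n \<sigma>)))"
    by (auto simp: hard_instance_def sorted_append comp_def map_replicate_const map_Suc_upt)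
  ultimately show ?thesis
    using n by (auto simp: size_based_instance_def)
qed

text \<open>The request at \<open>\<sigma> i\<close> arrives only at time \<open>i + 1\<close>, so
  the decision at time \<open>t\<close> is made without knowledge of \<open>\<sigma> t\<close>. This
  leaves the adversary free to choose \<open>\<sigma> t\<close> against that decision.\<close>

lemma history_hard_instance_cong:
  assumes "\<And>i. i < t \<Longrightarrow> \<sigma> i = \<tau> i"
  shows "history (hard_instance n \<sigma>) t = history (hard_instance n \<tau>) t"
proof -
  have "filter (\<lambda>r. fst r \<le> t) (map (\<lambda>i. (Suc i, \<sigma> i)) [0..<n - 2]) =
        filter (\<lambda>r. fst r \<le> t) (map (\<lambda>i. (Suc i, \<tau> i)) [0..<n - 2])"
    using assms by (auto simp: filter_map comp_def)
  then show ?thesis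
    by (simp add: history_def hard_instance_def)
qed

section \<open>The offline optimum\<close>

lemma opt_cost_hard_instance:
  assumes n: "n \<ge> 2" and \<sigma>: "\<sigma> permutes {..<n}"
  shows "opt_cost (hard_instance n \<sigma>) \<le> 1"
proof -
  let ?I = "hard_instance n \<sigma>"
  define a where "a = \<sigma> (n - 2)"
  define b where "b = \<sigma> (n - 1)"
  define N where "N t = min t (n - 2)" for t
  \<comment> \<open>The points \<open>a\<close> and \<open>b\<close> are never requested again and
    are matched at time 0; \<open>min\<close> and \<open>max\<close> put the smaller position first.
    Each later request \<open>n + i\<close> is matched on arrival with the initial request at its
    own point.\<close>
  define \<mu> where "\<mu> t = insert (min a b, max a b) ((\<lambda>i. (\<sigma> i, n + i)) ` {..<N t})" for t
  have inj: "\<sigma> x = \<sigma> y \<longleftrightarrow> x = y" for x y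
    using permutes_inj[OF \<sigma>] by (auto dest: injD)
  have less: "\<sigma> x < n" if "x < n" for x
    using permutes_in_image[OF \<sigma>, of x] that by simp
  have img: "\<sigma> ` {..<n} = {..<n}"
    using \<sigma> by (rule permutes_image)
  have ab: "a \<noteq> b" "a < n" "b < n"
    using n less by (auto simp: a_def b_def inj)
  have fresh: "\<sigma> i \<noteq> a" "\<sigma> i \<noteq> b" "\<sigma> i < n" if "i < N t" for i t
    using that n less by (auto simp: a_def b_def inj N_def)
  have matched: "matched (\<mu> t) = {a, b} \<union> \<sigma> ` {..<N t} \<union> {n..<n + N t}" for t
  proof -
    have "(\<lambda>i. n + i) ` {..<N t} = {n..<n + N t}"
      by (simp add: lessThan_atLeast0 image_add_atLeastLessThan add.commute)
    then show ?thesis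
      by (auto simp: matched_def \<mu>_def image_image min_def max_def)
  qed
  have disj: "{fst e, snd e} \<inter> {fst e', snd e'} = {}"
    if "e \<in> \<mu> t" "e' \<in> \<mu> t" "e \<noteq> e'" for e e' t
    using that ab fresh(1,2)[of _ t] fresh(3)[of _ t]
    by (fastforce simp: \<mu>_def inj min_def max_def split: if_splits)
  have matching: "is_matching (\<mu> t)" for t
    unfolding is_matching_def
  proof (intro conjI ballI impI)
    fix e assume "e \<in> \<mu> t"
    then show "case e of (i, j) \<Rightarrow> i < j"
      using ab fresh(3)[of _ t] by (force simp: \<mu>_def)
  qed (use disj in blast)
  have "mono \<mu>"
    unfolding mono_def \<mu>_def N_def by fastforce
  moreover have "matched (\<mu> t) \<subseteq> arrived ?I t" for t
    using ab fresh(3)[of _ t] unfolding matched arrived_hard_instance N_def by force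
  ultimately have sched: "schedule ?I \<mu>"
    using matching by (auto simp: schedule_def)
  \<comment> \<open>The last block holds the requests left waiting after time \<open>t\<close>; it
    has \<open>n - 2 - t\<close> elements, just what the delay function tolerates for free.\<close>
  have split: "{..<n} = {a, b} \<union> \<sigma> ` {..<N t} \<union> \<sigma> ` {N t..<n - 2}" for t
  proof -
    have "{..<n} = {n - 2, n - 1} \<union> {..<N t} \<union> {N t..<n - 2}"
      using n by (auto simp: N_def)
    then have "\<sigma> ` {..<n} = \<sigma> ` ({n - 2, n - 1} \<union> {..<N t} \<union> {N t..<n - 2})"
      by simp
    then show ?thesis
      unfolding img by (simp add: image_Un a_def b_def)
  qed
  have "matched (\<mu> (n - 2)) = {..<n + (n - 2)}"
  proof -
    have "matched (\<mu> (n - 2)) = {..<n} \<union> {n..<n + (n - 2)}"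
      unfolding matched split[of "n - 2"] by (simp add: N_def)
    then show ?thesis by (simp add: ivl_disj_un_one(2))
  qed
  then have perf: "eventually_perfect ?I \<mu>"
    unfolding eventually_perfect_def by auto
  have no_delay: "delay ?I t (arrived ?I t - matched (\<mu> t)) = 0" for t
  proof -
    have "arrived ?I t - matched (\<mu> t) \<subseteq> \<sigma> ` {N t..<n - 2}"
    proof
      fix x assume x: "x \<in> arrived ?I t - matched (\<mu> t)"
      then have "x \<in> {..<n}"
        by (auto simp: matched arrived_hard_instance N_def)
      with x show "x \<in> \<sigma> ` {N t..<n - 2}"
        unfolding matched split[of t] by blast
    qed
    then have "card (arrived ?I t - matched (\<mu> t)) \<le> card (\<sigma> ` {N t..<n - 2})"
      by (intro card_mono) auto
    also have "\<dots> \<le> card {N t..<n - 2}"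
      by (intro card_image_le) auto
    also have "\<dots> = n - 2 - t"
      by (simp add: N_def)
    finally show ?thesis by simp
  qed
  have "\<mu> t \<subseteq> \<mu> (n - 2)" for t
    by (auto simp: \<mu>_def N_def)
  then have "(\<Union>t. \<mu> t) = \<mu> (n - 2)"
    by blast
  moreover have "connection_cost ?I (\<mu> (n - 2)) \<le> 1"
  proof -
    let ?c = "\<lambda>(i, j). metric ?I (snd (requests ?I ! i)) (snd (requests ?I ! j))"
    let ?F = "(\<lambda>i. (\<sigma> i, n + i)) ` {..<N (n - 2)}"
    have "sum ?c ?F = 0"
      using fresh(3)[of _ "n - 2"] by (intro sum.neutral) (auto simp: N_def)
    moreover have "(min a b, max a b) \<notin> ?F"
      using ab by auto
    ultimately show ?thesis
      by (simp add: connection_cost_def \<mu>_def del: hard_instance_simps(2)) simp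
  qed
  ultimately have "total_cost ?I \<mu> \<le> 1"
    unfolding total_cost_def no_delay by (simp add: ennreal_le_1)
  moreover have "opt_cost ?I \<le> total_cost ?I \<mu>"
    unfolding opt_cost_def using sched perf by (intro INF_lower) auto
  ultimately show ?thesis by (rule order.trans[rotated])
qed

section \<open>Losses and the cost they force\<close>

text \<open>
  Overcrowding counts as a loss, so that every algorithm has at least two losing points at each
  step, even one that has incurred a prohibitive delay.
\<close>

definition loss :: "nat \<Rightarrow> (nat \<Rightarrow> nat) \<Rightarrow> nat \<Rightarrow> matching \<Rightarrow> bool" where
  "loss n \<sigma> k M \<longleftrightarrow> \<sigma> k \<in> matched M \<or> card ({..<n + k} - matched M) > n - 2 - k"

lemma measurable_loss [measurable]: "Measurable.pred (count_space UNIV) (loss n \<sigma> k)"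
  by simp

lemma card_matched_le:
  assumes "finite M"
  shows "card (matched M) \<le> 2 * card M"
proof -
  have "card (matched M) \<le> card (fst ` M) + card (snd ` M)"
    unfolding matched_def by (rule card_Un_le)
  also have "\<dots> \<le> 2 * card M"
    using card_image_le[OF assms, of fst] card_image_le[OF assms, of snd] by simp
  finally show ?thesis .
qed

text \<open>If some step is overcrowded, its single charge of \<open>n\<close> pays for all losses.
  Otherwise a loss at \<open>k\<close> rules out the free pair of \<open>\<sigma> k\<close> and
  \<open>n + k\<close>, and every pair that is not free costs 1.\<close>

lemma card_losses_le_total_cost:
  assumes n: "n \<ge> 2" and \<sigma>: "\<sigma> permutes {..<n}"
    and sched: "schedule (hard_instance n \<sigma>) \<mu>"
    and perf: "eventually_perfect (hard_instance n \<sigma>) \<mu>"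
  shows "ennreal (real (card {k. k < n - 2 \<and> loss n \<sigma> k (\<mu> k)}))
           \<le> total_cost (hard_instance n \<sigma>) \<mu>"
proof -
  let ?I = "hard_instance n \<sigma>"
  let ?L = "{k. k < n - 2 \<and> loss n \<sigma> k (\<mu> k)}"
  have cL: "card ?L \<le> n - 2"
    using card_mono[of "{..<n - 2}" ?L] by auto
  have arr: "arrived ?I k = {..<n + k}" if "k < n - 2" for k
    using that by (simp add: arrived_hard_instance)
  show ?thesis
  proof (cases "\<exists>k < n - 2. card ({..<n + k} - matched (\<mu> k)) > n - 2 - k")
    case True
    then obtain k where k: "k < n - 2" "card ({..<n + k} - matched (\<mu> k)) > n - 2 - k"
      by blast
    have "ennreal (real (card ?L)) \<le> ennreal (real n)"
      using cL by (intro ennreal_leI) simp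
    also have "\<dots> = ennreal (delay ?I k (arrived ?I k - matched (\<mu> k)))"
      using k by (simp add: arr)
    also have "\<dots> \<le> (\<Sum>t. ennreal (delay ?I t (arrived ?I t - matched (\<mu> t))))"
      using sum_le_suminf[OF summableI, of "{k}"
          "\<lambda>t. ennreal (delay ?I t (arrived ?I t - matched (\<mu> t)))"]
      by (simp del: hard_instance_simps)
    also have "\<dots> \<le> total_cost ?I \<mu>"
      unfolding total_cost_def by simp
    finally show ?thesis .
  next
    case False
    then have lossD: "\<sigma> k \<in> matched (\<mu> k)" if "k \<in> ?L" for k
      using that by (auto simp: loss_def)
    have mono: "\<mu> s \<subseteq> \<mu> t" if "s \<le> t" for s t
      using sched that by (auto simp: schedule_def mono_def)
    have matching: "is_matching (\<mu> t)" and matched_arr: "matched (\<mu> t) \<subseteq> arrived ?I t" for t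
      using sched by (auto simp: schedule_def)
    have bounded: "\<mu> t \<subseteq> {..<n + (n - 2)} \<times> {..<n + (n - 2)}" for t
    proof -
      have "matched (\<mu> t) \<subseteq> {..<n + (n - 2)}"
        using matched_arr[of t] by (auto simp: arrived_def)
      then show ?thesis by (force simp: matched_def)
    qed
    from perf obtain T where T: "matched (\<mu> T) = {..<n + (n - 2)}"
      by (auto simp: eventually_perfect_def)
    have finU: "finite (\<Union>t. \<mu> t)"
      using bounded by (intro finite_subset[OF UN_least[of UNIV \<mu> "{..<n + (n - 2)} \<times> {..<n + (n - 2)}"]]) auto
    then have fin: "finite (\<mu> T)"
      by (rule finite_subset[rotated]) auto
    let ?c = "\<lambda>(i, j). metric ?I (snd (requests ?I ! i)) (snd (requests ?I ! j))"
    let ?F = "(\<lambda>k. (\<sigma> k, n + k)) ` ({..<n - 2} - ?L)"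
    have free: "e \<in> ?F" if e: "e \<in> \<mu> T" and c: "?c e = 0" for e
    proof -
      obtain i j where ij: "e = (i, j)" by (cases e)
      have "i < j" using matching[of T] e ij by (auto simp: is_matching_def)
      have "j < n + (n - 2)" using bounded[of T] e ij by auto
      have inj: "\<sigma> x = \<sigma> y \<longleftrightarrow> x = y" for x y
        using permutes_inj[OF \<sigma>] by (auto dest: injD)
      have loc: "snd (requests ?I ! i) = snd (requests ?I ! j)"
        using c ij by (auto split: if_splits)
      \<comment> \<open>Initial requests lie at distinct points, and so do later ones by injectivity
        of \<open>\<sigma>\<close>. A free pair therefore joins one of each kind.\<close>
      have "\<not> j < n"
        using loc \<open>i < j\<close> by auto
      then obtain k where k: "j = n + k" "k < n - 2"
        using \<open>j < n + (n - 2)\<close> by (metis le_Suc_ex not_less nat_add_left_cancel_less)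
      have "i < n"
      proof (rule ccontr)
        assume "\<not> i < n"
        then obtain l where "i = n + l" by (metis le_Suc_ex not_less)
        then show False using loc \<open>i < j\<close> k by (simp add: inj)
      qed
      then have i: "i = \<sigma> k"
        using loc k by simp
      \<comment> \<open>After a loss at \<open>k\<close>, the request \<open>\<sigma> k\<close> is
        irrevocably matched at time \<open>k\<close>, before \<open>n + k\<close> has arrived, hence
        to another partner.\<close>
      have "k \<notin> ?L"
      proof
        assume "k \<in> ?L"
        then obtain e' where e': "e' \<in> \<mu> k" "\<sigma> k \<in> {fst e', snd e'}"
          using lossD by (force simp: matched_def)
        have "e \<in> \<mu> (max T k)" "e' \<in> \<mu> (max T k)"
          using e e' mono[of T "max T k"] mono[of k "max T k"] by auto
        moreover have "{fst e, snd e} \<inter> {fst e', snd e'} \<noteq> {}"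
          using e' ij i by auto
        ultimately have "e = e'"
          using matching[of "max T k"] unfolding is_matching_def by blast
        then have "n + k \<in> matched (\<mu> k)"
          using e' ij k by (force simp: matched_def)
        then show False
          using matched_arr[of k] k by (auto simp: arr)
      qed
      with i k ij show ?thesis by auto
    qed
    \<comment> \<open>A perfect matching has at least \<open>n - 1\<close> pairs, of which at most
      \<open>n - 2 - card ?L\<close> are free.\<close>
    have "n + (n - 2) \<le> 2 * card (\<mu> T)"
      using card_matched_le[OF fin] by (simp add: T)
    moreover have "card ({..<n - 2} - ?L) = n - 2 - card ?L"
      by (subst card_Diff_subset) auto
    then have "card ?F \<le> n - 2 - card ?L"
      using card_image_le[of "{..<n - 2} - ?L" "\<lambda>k. (\<sigma> k, n + k)"] by simp
    moreover have "card (\<mu> T) - card ?F \<le> card (\<mu> T - ?F)"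
      by (intro diff_card_le_card_Diff) auto
    ultimately have "card ?L \<le> card (\<mu> T - ?F)"
      using cL n by linarith
    then have "real (card ?L) \<le> (\<Sum>e\<in>\<mu> T - ?F. 1)"
      by simp
    also have "\<dots> \<le> (\<Sum>e\<in>\<mu> T - ?F. ?c e)"
    proof (intro sum_mono)
      fix e assume "e \<in> \<mu> T - ?F"
      with free have "?c e \<noteq> 0" by blast
      then show "1 \<le> ?c e" by (cases e) (auto split: if_splits)
    qed
    also have "\<dots> \<le> (\<Sum>e\<in>(\<Union>t. \<mu> t). ?c e)"
      by (intro sum_mono2 finU) (auto split: if_splits)
    finally have "ennreal (real (card ?L)) \<le> ennreal (connection_cost ?I (\<Union>t. \<mu> t))"
      unfolding connection_cost_def by (rule ennreal_leI)
    also have "\<dots> \<le> total_cost ?I \<mu>"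
      unfolding total_cost_def by simp
    finally show ?thesis .
  qed
qed

section \<open>The choice of the permutation by the adversary\<close>

lemma card_unrequested:
  assumes \<sigma>: "\<sigma> permutes {..<n}" and k: "k \<le> n"
  shows "card ({..<n} - \<sigma> ` {..<k}) = n - k"
proof -
  have "\<sigma> ` {..<k} \<subseteq> \<sigma> ` {..<n}"
    using k by (intro image_mono) simp
  then have "\<sigma> ` {..<k} \<subseteq> {..<n}"
    by (simp only: permutes_image[OF \<sigma>])
  then show ?thesis
    using permutes_inj_on[OF \<sigma>] by (simp add: card_Diff_subset card_image)
qed

text \<open>The transposition puts \<open>v\<close> at position \<open>k\<close>. Under overcrowding
  all \<open>n - k\<close> candidates lose; otherwise the candidates with a pending initial request
  are among at most \<open>n - 2 - k\<close> pending requests, so at least two lose.\<close>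

lemma loss_transpose_count:
  fixes M :: matching
  assumes \<sigma>: "\<sigma> permutes {..<n}" and k: "k < n - 2"
  shows "2 \<le> card {v \<in> {..<n} - \<sigma> ` {..<k}. loss n (Transposition.transpose (\<sigma> k) v \<circ> \<sigma>) k M}"
proof -
  let ?R = "{..<n} - \<sigma> ` {..<k}"
  let ?U = "{..<n + k} - matched M"
  have R: "card ?R = n - k"
    using k by (intro card_unrequested[OF \<sigma>]) simp
  have eq: "{v \<in> ?R. loss n (Transposition.transpose (\<sigma> k) v \<circ> \<sigma>) k M} =
      (if card ?U > n - 2 - k then ?R else ?R - ?U)"
    by (auto simp: loss_def)
  show ?thesis
  proof (cases "card ?U > n - 2 - k")
    case True
    then show ?thesis unfolding eq using R k by simp
  next
    case False
    have "card ?R - card ?U \<le> card (?R - ?U)"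
      by (intro diff_card_le_card_Diff) auto
    with False show ?thesis unfolding eq using R k by simp
  qed
qed

text \<open>The permutation is built position by position: step \<open>m\<close> swaps a suitable
  \<open>v\<close> into position \<open>m\<close>, which keeps the earlier values and hence the
  earlier loss events.\<close>

lemma exists_hard_permutation:
  fixes P :: "'w measure"
  assumes alg: "randomised_online_algorithm P A" and n: "n \<ge> 2" and m: "m \<le> n - 2"
  shows "\<exists>\<sigma>. \<sigma> permutes {..<n} \<and>
           2 * (harm n - harm (n - m)) \<le>
             (\<Sum>k<m. measure P {w \<in> space P. loss n \<sigma> k (run (A w) (hard_instance n \<sigma>) k)})"
  using m
proof (induction m)
  case 0
  then show ?case by (intro exI[of _ id] conjI permutes_id) simp
next
  case (Suc m)
  interpret prob_space P using alg by (simp add: randomised_online_algorithm_def)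
  define E where
    "E \<sigma> k = {w \<in> space P. loss n \<sigma> k (run (A w) (hard_instance n \<sigma>) k)}" for \<sigma> k
  from Suc obtain \<sigma> where \<sigma>: "\<sigma> permutes {..<n}"
    and sum: "2 * (harm n - harm (n - m)) \<le> (\<Sum>k<m. prob (E \<sigma> k))"
    by (auto simp: E_def)
  have m: "m < n - 2" using Suc.prems by simp
  let ?R = "{..<n} - \<sigma> ` {..<m}"
  define \<tau> where "\<tau> v = Transposition.transpose (\<sigma> m) v \<circ> \<sigma>" for v
  have inj: "inj \<sigma>" using \<sigma> by (rule permutes_inj)
  have \<tau>: "\<tau> v permutes {..<n}" if "v \<in> ?R" for v
    unfolding \<tau>_def using that m permutes_in_image[OF \<sigma>, of m]
    by (intro permutes_compose[OF \<sigma>] permutes_swap_id) auto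
  have agree: "\<tau> v i = \<sigma> i" if "v \<in> ?R" "i < m" for v i
    using that inj by (auto simp: \<tau>_def Transposition.transpose_def dest: injD)
  have hist: "history (hard_instance n (\<tau> v)) k = history (hard_instance n \<sigma>) k"
    if "v \<in> ?R" "k \<le> m" for v k
    using agree that by (intro history_hard_instance_cong) auto
  have E_agree: "E (\<tau> v) k = E \<sigma> k" if "v \<in> ?R" "k < m" for v k
    using hist[of v k] agree[of v k] that by (simp add: E_def loss_def run_def)
  \<comment> \<open>All candidates \<open>v\<close> face the same run up to time \<open>m\<close>,
    so for each outcome \<open>w\<close> one matching can be tested against all of them.\<close>
  have E_\<tau>: "E (\<tau> v) m = {w \<in> space P. loss n (\<tau> v) m (run (A w) (hard_instance n \<sigma>) m)}"
    if "v \<in> ?R" for v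
    using hist[of v m] that by (simp add: E_def run_def)
  have [measurable]: "(\<lambda>w. run (A w) (hard_instance n \<sigma>) m) \<in> measurable P (count_space UNIV)"
    using alg size_based_instance_hard_instance[OF n \<sigma>]
    by (auto simp: randomised_online_algorithm_def)
  have E_sets: "E (\<tau> v) m \<in> events" if "v \<in> ?R" for v
    unfolding E_\<tau>[OF that] by measurable
  have E_space: "E \<upsilon> k \<inter> space P = E \<upsilon> k" for \<upsilon> k
    by (auto simp: E_def)
  have E_int: "integrable P (indicat_real (E (\<tau> v) m))" if "v \<in> ?R" for v
    using E_sets[OF that] by (simp add: emeasure_eq_measure)
  \<comment> \<open>The expected number of losing candidates is at least 2, because the number is at
    least 2 for every outcome.\<close>
  have "2 \<le> (\<Sum>v\<in>?R. prob (E (\<tau> v) m))"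
  proof -
    have "(2 :: real) = expectation (\<lambda>w. 2)"
      by (simp add: prob_space)
    also have "\<dots> \<le> expectation (\<lambda>w. \<Sum>v\<in>?R. indicator (E (\<tau> v) m) w)"
    proof (intro integral_mono)
      fix w assume w: "w \<in> space P"
      let ?M = "run (A w) (hard_instance n \<sigma>) m"
      have "(\<Sum>v\<in>?R. indicator (E (\<tau> v) m) w :: real) = (\<Sum>v\<in>?R. of_bool (loss n (\<tau> v) m ?M))"
        using w by (intro sum.cong) (auto simp: E_\<tau> indicator_def)
      also have "\<dots> = card {v \<in> ?R. loss n (\<tau> v) m ?M}"
        by (simp add: of_bool_def sum.If_cases Int_def)
      finally show "(2 :: real) \<le> (\<Sum>v\<in>?R. indicator (E (\<tau> v) m) w)"
        using loss_transpose_count[OF \<sigma> m, of ?M] by (simp add: \<tau>_def)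
    qed (simp, intro Bochner_Integration.integrable_sum E_int)
    also have "\<dots> = (\<Sum>v\<in>?R. prob (E (\<tau> v) m))"
      using Bochner_Integration.integral_sum[of ?R P "\<lambda>v. indicat_real (E (\<tau> v) m)", OF E_int]
      by (simp add: E_space)
    finally show ?thesis .
  qed
  moreover have "card ?R = n - m"
    using m by (intro card_unrequested[OF \<sigma>]) simp
  ultimately obtain v where v: "v \<in> ?R" "2 / real (n - m) \<le> prob (E (\<tau> v) m)"
  proof -
    have False if "\<forall>v\<in>?R. prob (E (\<tau> v) m) < 2 / real (n - m)"
    proof -
      have "?R \<noteq> {}" using \<open>card ?R = n - m\<close> m by fastforce
      then have "(\<Sum>v\<in>?R. prob (E (\<tau> v) m)) < (\<Sum>v\<in>?R. 2 / real (n - m))"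
        using that by (intro sum_strict_mono) auto
      also have "\<dots> = 2"
        using m \<open>card ?R = n - m\<close> by (simp add: field_simps)
      finally show False using \<open>2 \<le> (\<Sum>v\<in>?R. prob (E (\<tau> v) m))\<close> by simp
    qed
    then show ?thesis using that by (meson not_le)
  qed
  \<comment> \<open>The gain \<open>2 / (n - m)\<close> of this step is twice one harmonic
    increment, so the bounds telescope.\<close>
  have "harm (n - m) = harm (n - Suc m) + 1 / real (n - m)"
    using m harm_Suc[of "n - Suc m", where 'a = real]
    by (simp add: Suc_diff_Suc inverse_eq_divide)
  then have "2 * (harm n - harm (n - Suc m)) = 2 * (harm n - harm (n - m)) + 2 / real (n - m)"
    by simp
  also have "\<dots> \<le> (\<Sum>k<m. prob (E (\<tau> v) k)) + prob (E (\<tau> v) m)"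
    using sum v E_agree[OF v(1)] by simp
  finally show ?case
    using \<tau>[OF v(1)] by (auto simp: E_def)
qed

section \<open>From loss probabilities to the competitive ratio\<close>

lemma expected_cost_hard_instance:
  fixes P :: "'w measure"
  assumes alg: "randomised_online_algorithm P A" and n: "n \<ge> 2" and \<sigma>: "\<sigma> permutes {..<n}"
  shows "ennreal (\<Sum>k<n - 2. measure P {w \<in> space P. loss n \<sigma> k (run (A w) (hard_instance n \<sigma>) k)})
           \<le> expected_cost P A (hard_instance n \<sigma>)"
proof -
  let ?I = "hard_instance n \<sigma>"
  let ?E = "\<lambda>k. {w \<in> space P. loss n \<sigma> k (run (A w) ?I k)}"
  interpret prob_space P using alg by (simp add: randomised_online_algorithm_def)
  have [measurable]: "\<And>k. (\<lambda>w. run (A w) ?I k) \<in> measurable P (count_space UNIV)"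
    and sched: "\<And>w. w \<in> space P \<Longrightarrow> schedule ?I (run (A w) ?I)"
    and perf: "AE w in P. eventually_perfect ?I (run (A w) ?I)"
    using alg size_based_instance_hard_instance[OF n \<sigma>]
    by (auto simp: randomised_online_algorithm_def)
  have E_sets: "?E k \<in> events" for k
    by measurable
  have "ennreal (\<Sum>k<n - 2. prob (?E k)) = (\<Sum>k<n - 2. emeasure P (?E k))"
    by (simp add: emeasure_eq_measure)
  also have "\<dots> = (\<Sum>k<n - 2. \<integral>\<^sup>+ w. indicator (?E k) w \<partial>P)"
    using E_sets by simp
  also have "\<dots> = (\<integral>\<^sup>+ w. (\<Sum>k<n - 2. indicator (?E k) w) \<partial>P)"
    using E_sets by (intro nn_integral_sum[symmetric]) auto
  also have "\<dots> \<le> (\<integral>\<^sup>+ w. total_cost ?I (run (A w) ?I) \<partial>P)"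
    using perf
  proof (intro nn_integral_mono_AE, eventually_elim)
    fix w assume perf: "eventually_perfect ?I (run (A w) ?I)"
    show "(\<Sum>k<n - 2. indicator (?E k) w) \<le> total_cost ?I (run (A w) ?I)"
    proof (cases "w \<in> space P")
      case True
      have "(\<Sum>k<n - 2. indicator (?E k) w :: ennreal) =
          (\<Sum>k<n - 2. of_bool (loss n \<sigma> k (run (A w) ?I k)))"
        using True by (intro sum.cong) (auto simp: indicator_def)
      also have "\<dots> = ennreal (real (card {k. k < n - 2 \<and> loss n \<sigma> k (run (A w) ?I k)}))"
        by (simp add: of_bool_def sum.If_cases Int_def ennreal_of_nat_eq_real_of_nat)
      finally show ?thesis
        using card_losses_le_total_cost[OF n \<sigma> sched[OF True] perf] by simp
    qed simp
  qed
  finally show ?thesis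
    by (simp add: expected_cost_def)
qed

text \<open>The optimum is at most 1, so the expected cost on the hard instance is a lower bound for
  every admissible \<open>c\<close>. Taking \<open>m = n - 2\<close> leaves \<open>harm 2\<close> as
  the subtracted term.\<close>

lemma harm_le_competitive_ratio:
  fixes P :: "'w measure"
  assumes alg: "randomised_online_algorithm P A" and n: "n \<ge> 2"
  shows "ennreal (2 * (harm n - harm 2)) \<le> competitive_ratio P A n"
  unfolding competitive_ratio_def
proof (rule Inf_greatest)
  fix c assume "c \<in> {c. competitive P A n c}"
  then have c: "competitive P A n c" by simp
  obtain \<sigma> where \<sigma>: "\<sigma> permutes {..<n}" and sum: "2 * (harm n - harm 2) \<le>
      (\<Sum>k<n - 2. measure P {w \<in> space P. loss n \<sigma> k (run (A w) (hard_instance n \<sigma>) k)})"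
    using exists_hard_permutation[OF alg n, of "n - 2"] n by auto
  have "ennreal (2 * (harm n - harm 2)) \<le> expected_cost P A (hard_instance n \<sigma>)"
    using ennreal_leI[OF sum] expected_cost_hard_instance[OF alg n \<sigma>] by (rule order.trans)
  also have "\<dots> \<le> c * opt_cost (hard_instance n \<sigma>)"
    using c size_based_instance_hard_instance[OF n \<sigma>] by (simp add: competitive_def)
  also have "\<dots> \<le> c * 1"
    using opt_cost_hard_instance[OF n \<sigma>] by (intro mult_left_mono) auto
  finally show "ennreal (2 * (harm n - harm 2)) \<le> c" by simp
qed

theorem theorem5:
  shows "\<exists>K > 0. \<exists>N. \<forall>n \<ge> N. \<forall>(P :: 'w measure) A.
           randomised_online_algorithm P A \<longrightarrow>
           ennreal (K * ln (real n)) \<le> competitive_ratio P A n"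
\<comment> \<open>As \<open>harm 2 = 3 / 2\<close>, the bound is at least
  \<open>2 * ln n - 3\<close>, which reaches \<open>ln n\<close> once \<open>ln n\<close> is at
  least 3; hence the threshold \<open>exp 3\<close>.\<close>
proof (intro exI[of _ "1 :: real"] exI[of _ "max 2 (nat \<lceil>exp 3 :: real\<rceil>)"] conjI allI impI)
  fix n and P :: "'w measure" and A
  assume n: "max 2 (nat \<lceil>exp 3 :: real\<rceil>) \<le> n" and alg: "randomised_online_algorithm P A"
  have n2: "n \<ge> 2" and "exp 3 \<le> real n"
    using n by (simp, linarith)
  then have "3 \<le> ln (real n)"
    by (subst ln_ge_iff) auto
  moreover have "ln (real n) \<le> ln (real n + 1)"
    using n2 by simp
  moreover have "ln (real n + 1) \<le> harm n"
    by (rule ln_le_harm)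
  moreover have "harm 2 = (3 / 2 :: real)"
    by (simp add: harm_expand)
  ultimately have "1 * ln (real n) \<le> 2 * (harm n - harm 2)"
    by simp
  then show "ennreal (1 * ln (real n)) \<le> competitive_ratio P A n"
    using harm_le_competitive_ratio[OF alg n2] by (meson ennreal_leI order.trans)
qed simp

end
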